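(* Let $X$ and $Y$ be two Banach spaces, let $1\le p<\infty$, and let $Z=X\oplus_p Y$. Then $Z$ has $BDP$ if and only if $X$ or $Y$ has $BDP$.
   Context: All Banach spaces are real and nontrivial. For a Banach space $E$, $B_E$ is the closed unit ball and $S_E$ the unit sphere. A slice of $B_E$ is a set $S(B_E,x^*,\alpha)=\{x\in B_E: x^*(x)>1-\alpha\}$ with $x^*\in S_{E^*}$ and $\alpha>0$. $E$ has the Ball Dentable Property ($BDP$) if for every $\varepsilon>0$ there is a slice of $B_E$ with diameter less than $\varepsilon$. $X\oplus_p Y$ is $X\times Y$ with norm $\|(x,y)\|=(\|x\|^p+\|y\|^p)^{1/p}$. *)

theory Defs
  imports "HOL-Analysis.Analysis"
begin

text \<open>The exponent \<open>p\<close> of the direct sum is a variable, so its norm cannot be a type-class instance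
  (the instance on \<open>'a \<times> 'b\<close> is the case \<open>p = 2\<close>). Hence the notions below take the norm \<open>N\<close> of a
  real vector space as an argument. For \<open>N = norm\<close> they agree with the library's notions, see
  \<open>bdp_norm_iff\<close>.\<close>

definition lp_sum_norm ::
  "real \<Rightarrow> 'a::real_normed_vector \<times> 'b::real_normed_vector \<Rightarrow> real" where
  "lp_sum_norm p z = (norm (fst z) powr p + norm (snd z) powr p) powr (1 / p)"

definition dual_space :: "('v::real_vector \<Rightarrow> real) \<Rightarrow> ('v \<Rightarrow> real) set" where
  "dual_space N = {f. linear f \<and> (\<exists>K. \<forall>x. \<bar>f x\<bar> \<le> K * N x)}"

text \<open>As in \<^const>\<open>onorm\<close>, the quotient is \<open>0\<close> at \<open>x = 0\<close>.\<close>

definition dual_norm :: "('v::real_vector \<Rightarrow> real) \<Rightarrow> ('v \<Rightarrow> real) \<Rightarrow> real" where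
  "dual_norm N f = (SUP x. \<bar>f x\<bar> / N x)"

definition dual_sphere :: "('v::real_vector \<Rightarrow> real) \<Rightarrow> ('v \<Rightarrow> real) set" where
  "dual_sphere N = {f \<in> dual_space N. dual_norm N f = 1}"

definition unit_ball :: "('v::real_vector \<Rightarrow> real) \<Rightarrow> 'v set" where
  "unit_ball N = {x. N x \<le> 1}"

definition slice :: "'v set \<Rightarrow> ('v \<Rightarrow> real) \<Rightarrow> real \<Rightarrow> 'v set" where
  "slice B f \<alpha> = {x \<in> B. f x > 1 - \<alpha>}"

definition norm_diameter :: "('v::real_vector \<Rightarrow> real) \<Rightarrow> 'v set \<Rightarrow> real" where
  "norm_diameter N S = (if S = {} then 0 else SUP (x, y) \<in> S \<times> S. N (x - y))"

definition bdp :: "('v::real_vector \<Rightarrow> real) \<Rightarrow> bool" where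
  "bdp N \<longleftrightarrow> (\<forall>\<epsilon>>0. \<exists>f\<in>dual_sphere N. \<exists>\<alpha>>0.
     norm_diameter N (slice (unit_ball N) f \<alpha>) < \<epsilon>)"

lemma lp_sum_norm_2: "lp_sum_norm 2 z = norm z"
  by (simp add: lp_sum_norm_def norm_prod_def powr_half_sqrt)

lemma dual_space_norm: "dual_space norm = {f. bounded_linear f}"
  by (auto simp: dual_space_def bounded_linear_def bounded_linear_axioms_def mult.commute)

lemma dual_norm_norm: "dual_norm norm f = onorm f"
  by (simp add: dual_norm_def onorm_def)

lemma unit_ball_norm: "unit_ball norm = cball 0 1"
  by (auto simp: unit_ball_def)

lemma norm_diameter_norm: "norm_diameter norm S = diameter S"
  by (simp add: norm_diameter_def diameter_def dist_norm)

lemma bdp_norm_iff: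
  "bdp (norm :: 'a::real_normed_vector \<Rightarrow> real) \<longleftrightarrow>
    (\<forall>\<epsilon>>0. \<exists>f :: 'a \<Rightarrow>\<^sub>L real. norm f = 1 \<and>
      (\<exists>\<alpha>>0. diameter (slice (cball 0 1) (blinfun_apply f) \<alpha>) < \<epsilon>))"
proof -
  have *: "(\<exists>f\<in>dual_sphere norm. P f) \<longleftrightarrow> (\<exists>f :: 'a \<Rightarrow>\<^sub>L real. norm f = 1 \<and> P (blinfun_apply f))" for P
    unfolding dual_sphere_def dual_space_norm dual_norm_norm
    by (simp add: norm_blinfun.rep_eq)
      (metis blinfun.bounded_linear_right bounded_linear_Blinfun_apply)
  show ?thesis
    unfolding bdp_def norm_diameter_norm unit_ball_norm * ..
qed

end

theory Submission
  imports Defs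
begin

text \<open>If \<open>f\<close> defines a slice of the unit ball of \<open>X\<close> of small diameter, then \<open>(x, y) \<mapsto> f x\<close> defines one
  of the unit ball of \<open>Z\<close>: near the maximum of \<open>f\<close> the norm of \<open>x\<close> is close to \<open>1\<close>, which forces
  \<open>y\<close> to be small. Conversely, let all slices of the unit balls of \<open>X\<close> and \<open>Y\<close> have diameter at least
  \<open>\<epsilon>\<close>, and let \<open>(x\<^sub>0, y\<^sub>0)\<close> lie in a slice of the unit ball of \<open>Z\<close>. Fixing \<open>y\<^sub>0\<close>, the points \<open>x\<close> with
  \<open>\<parallel>x\<parallel> \<le> \<parallel>x\<^sub>0\<parallel>\<close> and \<open>(x, y\<^sub>0)\<close> in the slice contain a multiple by \<open>\<parallel>x\<^sub>0\<parallel>\<close> of a slice of the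
  unit ball of \<open>X\<close>; symmetrically for \<open>Y\<close>. One of \<open>\<parallel>x\<^sub>0\<parallel>\<close>, \<open>\<parallel>y\<^sub>0\<parallel>\<close> can be taken at least
  \<open>1/4\<close>, which bounds the diameter of the slice from below.\<close>

section \<open>Powers and the norm of the direct sum\<close>

text \<open>The ratios \<open>a / (a + b)\<close> and \<open>b / (a + b)\<close> lie between 0 and
  1, so raising them to the power \<open>p\<close> does not increase them, and they sum to
  1.\<close>

lemma powr_add_le_add_powr:
  fixes a b p :: real
  assumes "0 \<le> a" "0 \<le> b" "1 \<le> p"
  shows "a powr p + b powr p \<le> (a + b) powr p"
proof (cases "a + b = 0")
  case False
  have *: "t powr p \<le> t / (a + b) * (a + b) powr p" if "0 \<le> t" "t \<le> a + b" for t
  proof -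
    have "(t / (a + b)) powr p \<le> (t / (a + b)) powr 1"
      using that assms by (intro powr_mono') (auto simp: divide_le_eq_1)
    then have "(t / (a + b)) powr p * (a + b) powr p \<le> t / (a + b) * (a + b) powr p"
      using that assms by (intro mult_right_mono) auto
    moreover have "(t / (a + b)) powr p * (a + b) powr p = t powr p"
      using that assms False by (simp flip: powr_mult)
    ultimately show ?thesis by simp
  qed
  have "a powr p + b powr p \<le> (a / (a + b) + b / (a + b)) * (a + b) powr p"
    unfolding distrib_right using assms by (intro add_mono *) auto
  then show ?thesis
    using False by (simp flip: add_divide_distrib)
next
  case True
  then have "a = 0" "b = 0"
    using assms by auto
  then show ?thesis by simp
qed

lemma lp_sum_norm_nonneg: "0 \<le> lp_sum_norm p z"
  by (simp add: lp_sum_norm_def)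

lemma lp_sum_norm_powr:
  "p \<noteq> 0 \<Longrightarrow> lp_sum_norm p z powr p = norm (fst z) powr p + norm (snd z) powr p"
  by (simp add: lp_sum_norm_def powr_powr)

lemma lp_sum_norm_swap: "lp_sum_norm p (prod.swap z) = lp_sum_norm p z"
  by (simp add: lp_sum_norm_def add.commute)

lemma lp_sum_norm_mono:
  assumes "0 < p" "norm (fst z) \<le> norm (fst w)" "norm (snd z) \<le> norm (snd w)"
  shows "lp_sum_norm p z \<le> lp_sum_norm p w"
  unfolding lp_sum_norm_def using assms by (intro powr_mono2 add_mono) auto

lemma lp_sum_norm_Pair_0: "0 < p \<Longrightarrow> lp_sum_norm p (x, 0) = norm x"
  and lp_sum_norm_0_Pair: "0 < p \<Longrightarrow> lp_sum_norm p (0, y) = norm y"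
  by (simp_all add: lp_sum_norm_def powr_powr)

lemma norm_fst_le_lp_sum_norm: "0 < p \<Longrightarrow> norm (fst z) \<le> lp_sum_norm p z"
  using lp_sum_norm_mono[of p "(fst z, 0)" z] by (simp add: lp_sum_norm_Pair_0)

lemma norm_snd_le_lp_sum_norm: "0 < p \<Longrightarrow> norm (snd z) \<le> lp_sum_norm p z"
  using lp_sum_norm_mono[of p "(0, snd z)" z] by (simp add: lp_sum_norm_0_Pair)

lemma lp_sum_norm_le_add:
  assumes "1 \<le> p"
  shows "lp_sum_norm p z \<le> norm (fst z) + norm (snd z)"
proof -
  have "lp_sum_norm p z \<le> ((norm (fst z) + norm (snd z)) powr p) powr (1 / p)"
    unfolding lp_sum_norm_def using assms by (intro powr_mono2 powr_add_le_add_powr) auto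
  then show ?thesis
    using assms by (simp add: powr_powr)
qed

lemma lp_sum_norm_scaleR:
  assumes "0 < p"
  shows "lp_sum_norm p (c *\<^sub>R z) = \<bar>c\<bar> * lp_sum_norm p z"
  using assms unfolding lp_sum_norm_def
  by (simp add: powr_mult powr_powr flip: distrib_left)

section \<open>Slices and functionals\<close>

lemma bounded_slice:
  fixes f :: "'a::real_normed_vector \<Rightarrow> real"
  shows "bounded (slice (cball 0 1) f \<alpha>)"
  using bounded_cball[of "0 :: 'a" 1] by (rule bounded_subset) (auto simp: slice_def)

lemma dual_norm_bound:
  assumes "f \<in> dual_space N" "\<And>x. 0 \<le> N x"
  shows "\<bar>f x\<bar> \<le> dual_norm N f * N x"
proof -
  obtain K where K: "\<bar>f x\<bar> \<le> K * N x" for x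
    using assms(1) by (auto simp: dual_space_def)
  \<comment> \<open>\<open>\<bar>K\<bar>\<close> rather than \<open>K\<close>: the quotient is
    \<open>0\<close> where \<open>N x = 0\<close>, and the sign of \<open>K\<close> is
    unknown.\<close>
  have "\<bar>f x\<bar> / N x \<le> \<bar>K\<bar>" for x
    using K[of x] assms(2)[of x]
    by (cases "N x = 0") (auto simp: divide_le_eq intro: order_trans mult_right_mono)
  then have "bdd_above (range (\<lambda>x. \<bar>f x\<bar> / N x))"
    by (auto intro!: bdd_aboveI)
  then have "\<bar>f x\<bar> / N x \<le> dual_norm N f"
    unfolding dual_norm_def by (intro cSUP_upper) auto
  then show ?thesis
    using K[of x] assms(2)[of x] by (cases "N x = 0") (auto simp: divide_le_eq)
qed

lemma dual_sphere_almost_attained: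
  assumes f: "f \<in> dual_sphere N" and N: "\<And>c x. N (c *\<^sub>R x) = \<bar>c\<bar> * N x" "\<And>x. 0 \<le> N x"
    and "c < 1"
  shows "\<exists>x. N x \<le> 1 \<and> c < f x"
proof -
  \<comment> \<open>The \<open>0\<close> in the maximum makes the quotient positive, which excludes
    \<open>N x = 0\<close> and \<open>f x = 0\<close>. Dividing \<open>x\<close> by
    \<open>N x\<close> and adjusting the sign then gives the point sought.\<close>
  have "max c 0 < (SUP x. \<bar>f x\<bar> / N x)"
    using assms by (simp add: dual_sphere_def dual_norm_def)
  then obtain x where x: "max c 0 < \<bar>f x\<bar> / N x"
    using less_cSupE[of "max c 0" "range (\<lambda>x. \<bar>f x\<bar> / N x)"] by blast
  then have "0 < N x"
    using N(2)[of x] by (cases "N x = 0") auto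
  moreover have "linear f"
    using f by (auto simp: dual_sphere_def dual_space_def)
  ultimately show ?thesis
    using x N(1)[of "sgn (f x) / N x" x]
    by (intro exI[of _ "(sgn (f x) / N x) *\<^sub>R x"])
      (auto simp: linear_scale abs_sgn mult.commute)
qed

section \<open>From a summand to the sum\<close>

text \<open>\<open>prod.swap\<close> is a linear isometry between the two sums, so composing with it
  transports functionals and their slices. This reduces the passage from a summand to the sum to the
  case of the first summand.\<close>

lemma bdp_lp_sum_norm_swap:
  assumes "bdp (lp_sum_norm p :: 'a::real_normed_vector \<times> 'b::real_normed_vector \<Rightarrow> real)"
  shows "bdp (lp_sum_norm p :: 'b \<times> 'a \<Rightarrow> real)"
  unfolding bdp_def
proof (intro allI impI)
  let ?N = "lp_sum_norm p :: 'a \<times> 'b \<Rightarrow> real" and ?M = "lp_sum_norm p :: 'b \<times> 'a \<Rightarrow> real"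
  fix \<epsilon> :: real assume "0 < \<epsilon>"
  then obtain f \<alpha> where f: "f \<in> dual_sphere ?N" and "0 < \<alpha>"
    and d: "norm_diameter ?N (slice (unit_ball ?N) f \<alpha>) < \<epsilon>"
    using assms unfolding bdp_def by blast
  let ?g = "\<lambda>z. f (prod.swap z)"
  have swap: "linear (prod.swap :: 'b \<times> 'a \<Rightarrow> 'a \<times> 'b)"
    by (auto intro!: linearI)
  have "range (\<lambda>z. \<bar>?g z\<bar> / ?M z) = (\<lambda>z. \<bar>f z\<bar> / ?N z) ` range prod.swap"
    by (simp only: image_image lp_sum_norm_swap)
  then have "dual_norm ?M ?g = dual_norm ?N f"
    by (simp only: dual_norm_def surj_swap)
  moreover have "?g \<in> dual_space ?M"
  proof -
    obtain K where "linear f" and K: "\<bar>f z\<bar> \<le> K * ?N z" for z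
      using f by (auto simp: dual_sphere_def dual_space_def)
    then have "linear ?g"
      using linear_compose[OF swap] by (simp add: comp_def)
    moreover have "\<bar>?g z\<bar> \<le> K * ?M z" for z
      using K[of "prod.swap z"] by (simp only: lp_sum_norm_swap)
    ultimately show ?thesis
      unfolding dual_space_def by blast
  qed
  ultimately have "?g \<in> dual_sphere ?M"
    using f by (simp add: dual_sphere_def)
  moreover have S: "slice (unit_ball ?N) f \<alpha> = prod.swap ` slice (unit_ball ?M) ?g \<alpha>"
    by (auto simp: slice_def unit_ball_def image_iff lp_sum_norm_def add.commute)
  have "norm_diameter ?N (slice (unit_ball ?N) f \<alpha>) = norm_diameter ?M (slice (unit_ball ?M) ?g \<alpha>)"
  proof -
    have *: "(prod.swap ` A) \<times> (prod.swap ` A) = map_prod prod.swap prod.swap ` (A \<times> A)"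
      for A :: "('b \<times> 'a) set"
      by force
    have "?N (prod.swap z - prod.swap w) = ?M (z - w)" for z w
      using lp_sum_norm_swap[of p "z - w"] by (simp add: prod.swap_def)
    then show ?thesis
      unfolding S norm_diameter_def * image_image by (simp add: case_prod_beta)
  qed
  ultimately show "\<exists>f\<in>dual_sphere ?M. \<exists>\<alpha>>0. norm_diameter ?M (slice (unit_ball ?M) f \<alpha>) < \<epsilon>"
    using d \<open>0 < \<alpha>\<close> by auto
qed

lemma bdp_lp_sum_norm_if_bdp_fst:
  assumes X: "bdp (norm :: 'a::real_normed_vector \<Rightarrow> real)" and p: "1 \<le> p"
  shows "bdp (lp_sum_norm p :: 'a \<times> 'b::real_normed_vector \<Rightarrow> real)"
  unfolding bdp_def
proof (intro allI impI)
  let ?N = "lp_sum_norm p :: 'a \<times> 'b \<Rightarrow> real"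
  fix \<epsilon> :: real assume \<epsilon>: "0 < \<epsilon>"
  then obtain f :: "'a \<Rightarrow> real" and \<alpha> where f: "bounded_linear f" "onorm f = 1" and \<alpha>: "0 < \<alpha>"
    and d: "diameter (slice (cball 0 1) f \<alpha>) < \<epsilon> / 2"
    using X[unfolded bdp_def, rule_format, of "\<epsilon> / 2"]
    unfolding dual_sphere_def dual_space_norm dual_norm_norm norm_diameter_norm unit_ball_norm
    by auto
  have f_le: "\<bar>f x\<bar> \<le> norm x" for x
    using onorm[OF f(1), of x] f(2) by simp
  \<comment> \<open>\<open>\<delta>\<close> will bound the second coordinate:
    \<open>\<epsilon> / 8\<close> makes \<open>\<epsilon> / 2 + 2 * \<delta>\<close> less than
    \<open>\<epsilon>\<close>, and \<open>1 / 2\<close> keeps \<open>1 - \<delta> powr p\<close>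
    positive.\<close>
  define \<delta> where "\<delta> = min (\<epsilon> / 8) (1 / 2)"
  \<comment> \<open>If \<open>f x > 1 - \<beta>\<close>, then \<open>norm x powr p\<close> is at
    least \<open>1 - \<delta> powr p\<close>, which leaves at most \<open>\<delta> powr p\<close>
    for the second coordinate. \<open>\<beta> \<le> \<alpha>\<close> keeps the first coordinate in
    the given slice.\<close>
  define \<beta> where "\<beta> = min \<alpha> (1 - (1 - \<delta> powr p) powr (1 / p))"
  have \<delta>: "0 < \<delta>" "\<delta> < 1" "\<delta> \<le> \<epsilon> / 8"
    using \<epsilon> by (auto simp: \<delta>_def)
  have \<delta>p: "0 < \<delta> powr p" "\<delta> powr p < 1"
    using \<delta> p powr_less_mono2[of p \<delta> 1] by auto
  then have "(1 - \<delta> powr p) powr (1 / p) < 1 powr (1 / p)"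
    using p by (intro powr_less_mono2) auto
  then have \<beta>: "0 < \<beta>" "\<beta> \<le> \<alpha>" "(1 - \<delta> powr p) powr (1 / p) \<le> 1 - \<beta>"
    using \<alpha> by (auto simp: \<beta>_def)
  let ?g = "\<lambda>z :: 'a \<times> 'b. f (fst z)"
  have abs_g: "\<bar>?g z\<bar> \<le> ?N z" for z
    using f_le[of "fst z"] norm_fst_le_lp_sum_norm[of p z] p by simp
  have "linear ?g"
    using linear_compose[OF linear_fst bounded_linear.linear[OF f(1)]] by (simp add: comp_def)
  then have g: "?g \<in> dual_space ?N"
    unfolding dual_space_def using abs_g by (auto intro!: exI[of _ 1])
  have "dual_norm ?N ?g = 1"
  proof (rule antisym)
    have le1: "\<bar>?g z\<bar> / ?N z \<le> 1" for z
      using abs_g[of z] lp_sum_norm_nonneg[of p z] by (simp add: divide_le_eq)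
    then show "dual_norm ?N ?g \<le> 1"
      unfolding dual_norm_def by (intro cSUP_least) auto
    have *: "\<bar>f x\<bar> \<le> dual_norm ?N ?g * norm x" for x
      using dual_norm_bound[OF g lp_sum_norm_nonneg, of "(x, 0)"] p
      by (simp add: lp_sum_norm_Pair_0)
    \<comment> \<open>\<open>onorm_bound\<close> asks for a nonnegative constant; a point where
      \<open>f\<close> does not vanish determines the sign.\<close>
    obtain x where "f x \<noteq> 0"
      using f onorm_eq_0[OF f(1)] by fastforce
    then have "0 < dual_norm ?N ?g * norm x"
      using *[of x] by (metis order_less_le_trans zero_less_abs_iff)
    then have "0 \<le> dual_norm ?N ?g"
      by (simp add: zero_less_mult_iff)
    with * have "onorm f \<le> dual_norm ?N ?g"
      by (intro onorm_bound) auto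
    then show "1 \<le> dual_norm ?N ?g"
      using f by simp
  qed
  with g have "?g \<in> dual_sphere ?N"
    by (simp add: dual_sphere_def)
  moreover have "norm_diameter ?N (slice (unit_ball ?N) ?g \<beta>) < \<epsilon>"
  proof -
    have snd_le: "norm (snd z) \<le> \<delta>" and fst_in: "fst z \<in> slice (cball 0 1) f \<alpha>"
      if "z \<in> slice (unit_ball ?N) ?g \<beta>" for z
    proof -
      have z: "?N z \<le> 1" "1 - \<beta> < f (fst z)"
        using that by (auto simp: slice_def unit_ball_def)
      then show "fst z \<in> slice (cball 0 1) f \<alpha>"
        using norm_fst_le_lp_sum_norm[of p z] p \<beta> by (auto simp: slice_def)
      have "(1 - \<delta> powr p) powr (1 / p) \<le> norm (fst z)"
        using z \<beta> f_le[of "fst z"] by simp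
      then have "((1 - \<delta> powr p) powr (1 / p)) powr p \<le> norm (fst z) powr p"
        using p by (intro powr_mono2) auto
      then have "1 - \<delta> powr p \<le> norm (fst z) powr p"
        using \<delta>p p by (simp add: powr_powr)
      moreover have "?N z powr p \<le> 1 powr p"
        using z p lp_sum_norm_nonneg[of p z] by (intro powr_mono2) auto
      ultimately have "norm (snd z) powr p \<le> \<delta> powr p"
        using p lp_sum_norm_powr[of p z] by simp
      then show "norm (snd z) \<le> \<delta>"
        using powr_less_mono2[of p \<delta> "norm (snd z)"] p \<delta> by force
    qed
    have "?N (z - w) \<le> \<epsilon> / 2 + 2 * \<delta>"
      if "z \<in> slice (unit_ball ?N) ?g \<beta>" "w \<in> slice (unit_ball ?N) ?g \<beta>" for z w
      using lp_sum_norm_le_add[OF p, of "z - w"] snd_le[OF that(1)] snd_le[OF that(2)] d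
        diameter_bounded_bound[OF bounded_slice fst_in[OF that(1)] fst_in[OF that(2)]]
        norm_triangle_ineq4[of "snd z" "snd w"]
      by (simp add: dist_norm)
    then have "norm_diameter ?N (slice (unit_ball ?N) ?g \<beta>) \<le> \<epsilon> / 2 + 2 * \<delta>"
      unfolding norm_diameter_def using \<epsilon> \<delta> by (auto intro!: cSUP_least)
    then show ?thesis
      using \<delta> \<epsilon> by simp
  qed
  ultimately show "\<exists>f\<in>dual_sphere ?N. \<exists>\<alpha>>0. norm_diameter ?N (slice (unit_ball ?N) f \<alpha>) < \<epsilon>"
    using \<beta> by blast
qed

section \<open>From the sum to a summand\<close>

text \<open>Failure of the property, rescaled to the ball of radius \<open>norm x\<close>. Here
  \<open>f\<close> is not normalized and may vanish, since it will be the restriction to a summand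
  of a functional on the sum.\<close>

lemma not_bdp_norm_imp_slices_large:
  assumes "\<not> bdp (norm :: 'a::real_normed_vector \<Rightarrow> real)"
  shows "\<exists>\<epsilon>>0. \<forall>(f :: 'a \<Rightarrow> real) c x. bounded_linear f \<longrightarrow> c < f x \<longrightarrow>
    (\<exists>u v. norm u \<le> norm x \<and> norm v \<le> norm x \<and> c < f u \<and> c < f v \<and> norm x * \<epsilon> \<le> norm (u - v))"
proof -
  obtain \<eta> where \<eta>: "0 < \<eta>"
    "\<And>(f :: 'a \<Rightarrow> real) \<alpha>. bounded_linear f \<Longrightarrow> onorm f = 1 \<Longrightarrow> 0 < \<alpha> \<Longrightarrow>
      \<eta> \<le> diameter (slice (cball 0 1) f \<alpha>)"
    using assms
    unfolding bdp_def dual_sphere_def dual_space_norm dual_norm_norm norm_diameter_norm unit_ball_norm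
    by (simp add: not_less) (metis not_less)
  show ?thesis
  \<comment> \<open>A diameter is a supremum, so two points are only sure to be more than
    \<open>\<eta> / 2\<close> apart; the bound \<open>1\<close> serves the degenerate case, which
    uses \<open>x\<close> and \<open>- x\<close>.\<close>
  proof (intro exI[of _ "min 1 (\<eta> / 2)"] conjI allI impI)
    fix f :: "'a \<Rightarrow> real" and c x
    assume f: "bounded_linear f" and c: "c < f x"
    interpret f: bounded_linear f by fact
    show "\<exists>u v. norm u \<le> norm x \<and> norm v \<le> norm x \<and> c < f u \<and> c < f v \<and>
      norm x * min 1 (\<eta> / 2) \<le> norm (u - v)"
    proof (cases "x = 0 \<or> onorm f = 0")
      case True
      then have "f (- x) = f x"
        using onorm_eq_0[OF f] by (auto simp: f.zero)
      moreover have "norm (x - - x) = 2 * norm x"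
        by (simp flip: scaleR_2)
      moreover have "norm x * min 1 (\<eta> / 2) \<le> norm x * 2"
        by (intro mult_left_mono) auto
      ultimately show ?thesis
        using c by (intro exI[of _ x] exI[of _ "- x"]) auto
    next
      case False
      define k where "k = onorm f"
      have k: "0 < k"
        using False onorm_pos_le[OF f] by (simp add: k_def)
      have x: "0 < norm x"
        using False by simp
      let ?g = "\<lambda>u. f u / k"
      have g: "bounded_linear ?g"
        using bounded_linear_compose[OF bounded_linear_divide f] .
      have "onorm ?g = 1"
        using onorm_scaleR[OF f, of "1 / k"] k by (simp add: k_def field_simps)
      moreover have "c < k * norm x"
        using c onorm[OF f, of x] by (simp add: k_def)
      \<comment> \<open>Scaled by \<open>norm x\<close>, this slice becomes the part of the ball of
        radius \<open>norm x\<close> where \<open>f\<close> exceeds \<open>c\<close>. Its width is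
        positive because \<open>c < k * norm x\<close>.\<close>
      ultimately have "\<eta> \<le> diameter (slice (cball 0 1) ?g (1 - c / (k * norm x)))"
        using k x by (intro \<eta>(2) g) auto
      then obtain u v where "u \<in> slice (cball 0 1) ?g (1 - c / (k * norm x))"
        "v \<in> slice (cball 0 1) ?g (1 - c / (k * norm x))" "\<eta> / 2 < norm (u - v)"
        using diameter_lower_bounded[OF bounded_slice, of "\<eta> / 2" ?g "1 - c / (k * norm x)"] \<eta>(1)
        unfolding dist_norm by auto
      then have uv: "norm u \<le> 1" "norm v \<le> 1" "c / (k * norm x) < f u / k"
        "c / (k * norm x) < f v / k" "\<eta> / 2 < norm (u - v)"
        by (auto simp: slice_def)
      have "norm (norm x *\<^sub>R u - norm x *\<^sub>R v) = norm x * norm (u - v)"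
        by (simp flip: scaleR_right_diff_distrib)
      then show ?thesis
        using uv k x
        by (intro exI[of _ "norm x *\<^sub>R u"] exI[of _ "norm x *\<^sub>R v"])
          (auto simp: f.scaleR field_simps mult_left_le)
    qed
  qed (use \<eta> in auto)
qed

text \<open>A real supremum bounds its members once they are bounded above. In the unit ball each
  coordinate has norm at most 1, so the two coordinate differences contribute at most 2
  each.\<close>

lemma norm_diameter_lp_sum_norm_upper:
  assumes "1 \<le> p" "z \<in> slice (unit_ball (lp_sum_norm p)) h \<alpha>" "w \<in> slice (unit_ball (lp_sum_norm p)) h \<alpha>"
  shows "lp_sum_norm p (z - w) \<le> norm_diameter (lp_sum_norm p) (slice (unit_ball (lp_sum_norm p)) h \<alpha>)"
proof -
  have "lp_sum_norm p (z' - w') \<le> 4"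
    if "lp_sum_norm p z' \<le> 1" "lp_sum_norm p w' \<le> 1" for z' w' :: "'a \<times> 'b"
    using that assms(1) lp_sum_norm_le_add[OF assms(1), of "z' - w'"]
      norm_fst_le_lp_sum_norm[of p z'] norm_snd_le_lp_sum_norm[of p z']
      norm_fst_le_lp_sum_norm[of p w'] norm_snd_le_lp_sum_norm[of p w']
      norm_triangle_ineq4[of "fst z'" "fst w'"] norm_triangle_ineq4[of "snd z'" "snd w'"]
    by simp
  then have "bdd_above ((\<lambda>(z, w). lp_sum_norm p (z - w)) `
      (slice (unit_ball (lp_sum_norm p)) h \<alpha> \<times> slice (unit_ball (lp_sum_norm p)) h \<alpha>))"
    by (intro bdd_aboveI[of _ 4]) (auto simp: slice_def unit_ball_def)
  from cSUP_upper[OF _ this, of "(z, w)"] show ?thesis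
    using assms by (auto simp: norm_diameter_def)
qed

lemma bdp_fst_or_snd_if_bdp_lp_sum_norm:
  assumes Z: "bdp (lp_sum_norm p :: 'a::real_normed_vector \<times> 'b::real_normed_vector \<Rightarrow> real)"
    and p: "1 \<le> p"
  shows "bdp (norm :: 'a \<Rightarrow> real) \<or> bdp (norm :: 'b \<Rightarrow> real)"
proof (rule ccontr)
  let ?N = "lp_sum_norm p :: 'a \<times> 'b \<Rightarrow> real"
  assume "\<not> ?thesis"
  then have X: "\<not> bdp (norm :: 'a \<Rightarrow> real)" and Y: "\<not> bdp (norm :: 'b \<Rightarrow> real)"
    by auto
  obtain \<epsilon> where \<epsilon>: "0 < \<epsilon>"
    and X: "\<And>(f :: 'a \<Rightarrow> real) c x. bounded_linear f \<Longrightarrow> c < f x \<Longrightarrow>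
      \<exists>u v. norm u \<le> norm x \<and> norm v \<le> norm x \<and> c < f u \<and> c < f v \<and> norm x * \<epsilon> \<le> norm (u - v)"
    using not_bdp_norm_imp_slices_large[OF X] by blast
  obtain \<eta> where \<eta>: "0 < \<eta>"
    and Y: "\<And>(f :: 'b \<Rightarrow> real) c x. bounded_linear f \<Longrightarrow> c < f x \<Longrightarrow>
      \<exists>u v. norm u \<le> norm x \<and> norm v \<le> norm x \<and> c < f u \<and> c < f v \<and> norm x * \<eta> \<le> norm (u - v)"
    using not_bdp_norm_imp_slices_large[OF Y] by blast
  \<comment> \<open>The factor \<open>1 / 4\<close> is the lower bound for the norm of the larger
    coordinate of \<open>z\<close>.\<close>
  define \<theta> where "\<theta> = min \<epsilon> \<eta> / 4"
  have "0 < \<theta>"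
    using \<epsilon> \<eta> by (simp add: \<theta>_def)
  then obtain h \<alpha> where h: "h \<in> dual_sphere ?N" and \<alpha>: "0 < \<alpha>"
    and d: "norm_diameter ?N (slice (unit_ball ?N) h \<alpha>) < \<theta>"
    using Z unfolding bdp_def by blast
  have close: "?N (z - w) < \<theta>"
    if "?N z \<le> 1" "?N w \<le> 1" "1 - \<alpha> < h z" "1 - \<alpha> < h w" for z w
    using norm_diameter_lp_sum_norm_upper[OF p, of z h \<alpha> w] d that
    by (simp add: slice_def unit_ball_def)
  have lin: "linear h" and h_le: "\<bar>h z\<bar> \<le> ?N z" for z
    using h dual_norm_bound[of h ?N z] lp_sum_norm_nonneg
    by (auto simp: dual_sphere_def dual_space_def)
  \<comment> \<open>\<open>1 - \<alpha>\<close> puts \<open>z\<close> into the slice;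
    \<open>1 / 2\<close> forces the norms of its coordinates to sum to more than
    \<open>1 / 2\<close>.\<close>
  obtain z where z: "?N z \<le> 1" "max (1 / 2) (1 - \<alpha>) < h z"
    using dual_sphere_almost_attained[OF h, of "max (1 / 2) (1 - \<alpha>)"] \<alpha> p
      lp_sum_norm_scaleR[of p] lp_sum_norm_nonneg[of p] by auto
  obtain x y where xy: "z = (x, y)"
    by fastforce
  have h_split: "h (u, v) = h (u, 0) + h (0, v)" for u v
    using linear_add[OF lin, of "(u, 0)" "(0, v)"] by simp
  have f: "bounded_linear (\<lambda>u. h (u, 0))"
    using h_le[of "(_, 0)"] p linear_add[OF lin, of "(_, 0)" "(_, 0)"]
      linear_scale[OF lin, of _ "(_, 0)"]
    by (intro bounded_linear_intro[of _ 1]) (auto simp: lp_sum_norm_Pair_0)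
  have g: "bounded_linear (\<lambda>v. h (0, v))"
    using h_le[of "(0, _)"] p linear_add[OF lin, of "(0, _)" "(0, _)"]
      linear_scale[OF lin, of _ "(0, _)"]
    by (intro bounded_linear_intro[of _ 1]) (auto simp: lp_sum_norm_0_Pair)
  have "1 / 2 < norm x + norm y"
    using z h_le[of z] lp_sum_norm_le_add[OF p, of z] xy by simp
  then consider "1 / 4 \<le> norm x" | "1 / 4 \<le> norm y"
    by linarith
  then show False
  proof cases
    case 1
    \<comment> \<open>The threshold is what remains for the first coordinate once \<open>y\<close>
      is fixed, so \<open>(u, y)\<close> and \<open>(v, y)\<close> satisfy the slice inequality;
      \<open>norm u, norm v \<le> norm x\<close> keeps them in the unit ball.\<close>
    obtain u v where uv: "norm u \<le> norm x" "norm v \<le> norm x" "1 - \<alpha> - h (0, y) < h (u, 0)"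
      "1 - \<alpha> - h (0, y) < h (v, 0)" "norm x * \<epsilon> \<le> norm (u - v)"
      using X[OF f, of "1 - \<alpha> - h (0, y)" x] z h_split[of x y] xy by auto
    have "?N (u, y) \<le> 1" "?N (v, y) \<le> 1"
      using lp_sum_norm_mono[of p "(u, y)" z] lp_sum_norm_mono[of p "(v, y)" z] p z(1) uv(1,2) xy
      by auto
    then have "?N ((u, y) - (v, y)) < \<theta>"
      using uv h_split[of u y] h_split[of v y] by (intro close) auto
    then have "norm (u - v) < \<theta>"
      using p by (simp add: lp_sum_norm_Pair_0)
    moreover have "1 / 4 * \<epsilon> \<le> norm x * \<epsilon>"
      using 1 \<epsilon> by (intro mult_right_mono) auto
    ultimately show False
      using uv(5) by (simp add: \<theta>_def)
  next
    case 2
    obtain u v where uv: "norm u \<le> norm y" "norm v \<le> norm y" "1 - \<alpha> - h (x, 0) < h (0, u)"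
      "1 - \<alpha> - h (x, 0) < h (0, v)" "norm y * \<eta> \<le> norm (u - v)"
      using Y[OF g, of "1 - \<alpha> - h (x, 0)" y] z h_split[of x y] xy by auto
    have "?N (x, u) \<le> 1" "?N (x, v) \<le> 1"
      using lp_sum_norm_mono[of p "(x, u)" z] lp_sum_norm_mono[of p "(x, v)" z] p z(1) uv(1,2) xy
      by auto
    then have "?N ((x, u) - (x, v)) < \<theta>"
      using uv h_split[of x u] h_split[of x v] by (intro close) auto
    then have "norm (u - v) < \<theta>"
      using p by (simp add: lp_sum_norm_0_Pair)
    moreover have "1 / 4 * \<eta> \<le> norm y * \<eta>"
      using 2 \<eta> by (intro mult_right_mono) auto
    ultimately show False
      using uv(5) by (simp add: \<theta>_def)
  qed
qed

theorem proposition2p4: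
  fixes p :: real
  assumes "\<exists>x :: 'a::banach. x \<noteq> 0"
    and "\<exists>y :: 'b::banach. y \<noteq> 0"
    and "1 \<le> p"
  shows "bdp (lp_sum_norm p :: 'a \<times> 'b \<Rightarrow> real) \<longleftrightarrow>
    bdp (norm :: 'a \<Rightarrow> real) \<or> bdp (norm :: 'b \<Rightarrow> real)"
  \<comment> \<open>For the second summand, the first-summand result is applied to
    \<open>'b \<times> 'a\<close> and then swapped.\<close>
  using bdp_fst_or_snd_if_bdp_lp_sum_norm[OF _ assms(3), where 'a = 'a and 'b = 'b]
    bdp_lp_sum_norm_if_bdp_fst[OF _ assms(3), where 'a = 'a and 'b = 'b]
    bdp_lp_sum_norm_swap[OF bdp_lp_sum_norm_if_bdp_fst[OF _ assms(3), where 'a = 'b and 'b = 'a]]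
  by blast

end
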